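(* For every rational number $m$, $$(91m^2+364m+21)^5+(7m^2-364m+273)^5+(-21m^2+308m+357)^5+(119m^2-308m-63)^5+(161m^2+56m-189)^5+(-63m^2-56m+483)^5$$ $$=(159m^2-92m-183)^5+(-61m^2+92m+477)^5+(127m^2+284m-87)^5+(-29m^2-284m+381)^5+(81m^2-376m+51)^5+(17m^2+376m+243)^5 .$$
   Context: This is a one-parameter family of solutions of $a^5+b^5+c^5+d^5+e^5+f^5=p^5+q^5+r^5+s^5+t^5+u^5$; here $m$ is a free parameter. *)

theory Defs
  imports Complex_Main
begin

end

theory Submission
  imports Defs
begin

text \<open>
  The bases on either side fall into three pairs with the common midpoint
  \<open>h = 49 (m\<^sup>2 + 3)\<close>, so that each side is a sum of terms \<open>(h + d)\<^sup>5 + (h - d)\<^sup>5\<close>, a polynomial in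
  \<open>h\<close> and \<open>d\<^sup>2\<close>. The three half-differences on a side have the form \<open>a + b, a, b\<close>, and for such a
  triple the sum of the squares and the sum of the fourth powers are functions of the single
  quadratic form \<open>a\<^sup>2 + a b + b\<^sup>2\<close> (lemma \<open>sum_fifth_powers_symmetric_triple\<close>). The identity thus
  reduces to a quadratic one: the pairs \<open>(a, b)\<close> from the two sides are two parametrized
  solutions of \<open>a\<^sup>2 + a b + b\<^sup>2 = (2 h)\<^sup>2\<close>.
\<close>

text \<open>
  By the binomial theorem the sum is \<open>6 h\<^sup>5 + 20 h\<^sup>3 s + 10 h t\<close>, where \<open>s\<close> and \<open>t\<close> are the sums of
  the squares and of the fourth powers of \<open>a + b\<close>, \<open>a\<close>, \<open>b\<close>. With \<open>N = a\<^sup>2 + a b + b\<^sup>2\<close> these are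
  \<open>s = 2 N\<close> and \<open>t = 2 N\<^sup>2\<close>.
\<close>

lemma sum_fifth_powers_symmetric_triple:
  fixes h a b :: "'a :: comm_ring_1"
  shows "(h + (a + b))^5 + (h - (a + b))^5 + (h + a)^5 + (h - a)^5 + (h + b)^5 + (h - b)^5
       = 6 * h^5 + 40 * h^3 * (a^2 + a * b + b^2) + 20 * h * (a^2 + a * b + b^2)^2"
  by (simp add: eval_nat_numeral algebra_simps)

theorem mainTheorem4:
  fixes m :: rat
  shows "(91 * m^2 + 364 * m + 21)^5 + (7 * m^2 - 364 * m + 273)^5
       + (- 21 * m^2 + 308 * m + 357)^5 + (119 * m^2 - 308 * m - 63)^5
       + (161 * m^2 + 56 * m - 189)^5 + (- 63 * m^2 - 56 * m + 483)^5
       = (159 * m^2 - 92 * m - 183)^5 + (- 61 * m^2 + 92 * m + 477)^5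
       + (127 * m^2 + 284 * m - 87)^5 + (- 29 * m^2 - 284 * m + 381)^5
       + (81 * m^2 - 376 * m + 51)^5 + (17 * m^2 + 376 * m + 243)^5"
proof -
  define h where "h = 49 * m^2 + 147"
  define a b where "a = - 70 * m^2 + 308 * m + 210" and "b = 112 * m^2 + 56 * m - 336"
  define c d where "c = 78 * m^2 + 284 * m - 234" and "d = 32 * m^2 - 376 * m - 96"
  have left_bases:
    "91 * m^2 + 364 * m + 21 = h + (a + b)" "7 * m^2 - 364 * m + 273 = h - (a + b)"
    "- 21 * m^2 + 308 * m + 357 = h + a" "119 * m^2 - 308 * m - 63 = h - a"
    "161 * m^2 + 56 * m - 189 = h + b" "- 63 * m^2 - 56 * m + 483 = h - b"
    unfolding h_def a_def b_def by simp_all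
  have right_bases:
    "159 * m^2 - 92 * m - 183 = h + (c + d)" "- 61 * m^2 + 92 * m + 477 = h - (c + d)"
    "127 * m^2 + 284 * m - 87 = h + c" "- 29 * m^2 - 284 * m + 381 = h - c"
    "81 * m^2 - 376 * m + 51 = h + d" "17 * m^2 + 376 * m + 243 = h - d"
    unfolding h_def c_def d_def by simp_all
  have "a^2 + a * b + b^2 = (2 * h)^2"
    unfolding h_def a_def b_def by algebra
  moreover have "c^2 + c * d + d^2 = (2 * h)^2"
    unfolding h_def c_def d_def by algebra
  ultimately show ?thesis
    unfolding left_bases right_bases sum_fifth_powers_symmetric_triple by simp
qed

end
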